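(* Let $n\ge 1$ and write $n=d_1d_2\cdots d_k$ with primes $d_1\le d_2\le\cdots\le d_k$. A longest directed path in the directed power graph of $\mathbb{Z}/n\mathbb{Z}$ has the following form: first all $\varphi(n)$ generators of $\mathbb{Z}/n\mathbb{Z}$, then all $\varphi(n/d_1)$ generators of the subgroup $d_1\mathbb{Z}/n\mathbb{Z}$ (of order $n/d_1$), then all $\varphi(n/(d_1d_2))$ generators of the subgroup $d_1d_2\mathbb{Z}/n\mathbb{Z}$, and so on, ending with the identity (the generator of $d_1\cdots d_k\mathbb{Z}/n\mathbb{Z}=\{0\}$).
   Context: The directed power graph of a group $G$ has vertex set $G$ and a directed edge $(x,y)$ whenever $x\ne y$ and $\langle y\rangle\le\langle x\rangle$. A directed path is a sequence of distinct vertices each joined to the next by a directed edge; its length is measured by its number of vertices. $\varphi$ is Euler's totient function. *)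

theory Defs
  imports
    "HOL-Algebra.Elementary_Groups"
    "HOL-Number_Theory.Totient"
    "Graph_Theory.Vertex_Walk"
begin

definition directed_power_graph :: "('a, 'b) monoid_scheme \<Rightarrow> ('a, 'a \<times> 'a) pre_digraph" where
  "directed_power_graph G =
     \<lparr> verts = carrier G,
       arcs = {(x, y). x \<in> carrier G \<and> y \<in> carrier G \<and> x \<noteq> y \<and> generate G {y} \<subseteq> generate G {x}},
       tail = fst,
       head = snd \<rparr>"

(* The length of a path is its number of vertices, i.e. the list length; vwalk_length would
   count arcs instead. *)
definition longest_vpath :: "'a vwalk \<Rightarrow> ('a, 'b) pre_digraph \<Rightarrow> bool" where
  "longest_vpath p D \<longleftrightarrow> vpath p D \<and> (\<forall>q. vpath q D \<longrightarrow> length q \<le> length p)"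

(* The subgroup dZ/nZ, as the image of dZ under reduction modulo n. *)
definition multiples_mod :: "nat \<Rightarrow> nat \<Rightarrow> int set" where
  "multiples_mod n d = range (\<lambda>z. (int d * z) mod int n)"

definition cyclic_generators :: "('a, 'b) monoid_scheme \<Rightarrow> 'a set \<Rightarrow> 'a set" where
  "cyclic_generators G H = {x \<in> carrier G. generate G {x} = H}"

end

theory Submission
  imports Defs
begin

text \<open>A directed path is a list of distinct elements whose orders form a divisor chain, so a longest
  one runs through all elements of each order in a maximal chain \<open>n = m\<^sub>0, m\<^sub>1, \<dots>, 1\<close> and has length
  \<open>\<Sum>i. totient m\<^sub>i\<close>. Suppose a chain first removes a prime \<open>q\<close> other than the smallest prime \<open>p\<close>
  of \<open>n\<close>. By induction it next removes \<open>p\<close>, and removing \<open>p\<close> first and then \<open>q\<close> replaces the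
  summand \<open>totient (n / q)\<close> by \<open>totient (n / p)\<close>, which is at least as large. Equality forces \<open>p\<close> to
  divide \<open>n / p\<close>, and then the new chain is not optimal below \<open>n / p\<close>. Hence removing the
  smallest prime at each step is the unique optimum.\<close>

section \<open>Totients of prime multiples\<close>

lemma totient_prime_mult:
  assumes "prime (p::nat)"
  shows "totient (p * r) = (if p dvd r then p else p - 1) * totient r"
proof (cases "p dvd r")
  case True
  with assms have "gcd p r = p" by (simp add: gcd_nat.absorb1)
  with totient_gcd[of p r] show ?thesis
    using True prime_gt_1_nat[OF assms] by (simp add: totient_prime[OF assms] mult.commute)
next
  case False
  with assms have "coprime p r" by (rule prime_imp_coprime)
  with False assms show ?thesis by (simp add: totient_mult_coprime totient_prime)
qed

text \<open>The factor \<open>p\<close> raises the totient at most \<open>p\<close> times, the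
  factor \<open>q\<close> at least \<open>q - 1\<close> times, and
  \<open>p \<le> q - 1\<close>.\<close>

lemma totient_prime_mult_mono:
  assumes "prime (p::nat)" "prime q" "p < q"
  shows "totient (p * r) \<le> totient (q * r)"
proof -
  have "totient (p * r) \<le> p * totient r" using assms(1) by (simp add: totient_prime_mult)
  also have "\<dots> \<le> (q - 1) * totient r" using assms(3) by (intro mult_right_mono) auto
  also have "\<dots> \<le> totient (q * r)" using assms(2) by (simp add: totient_prime_mult)
  finally show ?thesis .
qed

text \<open>Since \<open>p\<close> does not divide \<open>r\<close>, its factor is exactly
  \<open>p - 1\<close>, which is below \<open>q - 1\<close>; positivity of \<open>totient r\<close>
  keeps the inequality strict.\<close>

lemma totient_prime_mult_strict_mono:
  assumes "prime (p::nat)" "prime q" "p < q" "\<not> p dvd r" "r > 0"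
  shows "totient (p * r) < totient (q * r)"
proof -
  have "totient (p * r) = (p - 1) * totient r" using assms(1,4) by (simp add: totient_prime_mult)
  also have "\<dots> < (q - 1) * totient r"
    using assms prime_gt_1_nat[of p] by (intro mult_strict_right_mono) auto
  also have "\<dots> \<le> totient (q * r)" using assms(2) by (simp add: totient_prime_mult)
  finally show ?thesis .
qed

section \<open>Lists of primes and the lengths of divisor chains\<close>

lemma prod_list_remove1:
  "q \<in> set ds \<Longrightarrow> q * prod_list (remove1 q ds) = prod_list (ds :: 'a::comm_monoid_mult list)"
  by (induction ds) (auto simp: ac_simps)

lemma prime_dvd_prod_list_iff_mem:
  assumes "\<forall>d\<in>set ds. prime (d::nat)" "prime q"
  shows "q dvd prod_list ds \<longleftrightarrow> q \<in> set ds"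
  using assms by (induction ds) (auto simp: prime_dvd_mult_iff primes_dvd_imp_eq)

lemma prod_list_primes_pos: "\<forall>d\<in>set ds. prime (d::nat) \<Longrightarrow> prod_list ds > 0"
  by (induction ds) (auto simp: prime_gt_0_nat)

text \<open>The length of a path that takes all elements of each order while the primes are removed
  in list order. The base value is \<open>totient 1\<close>, which accounts for the
  identity.\<close>

fun chain_length :: "nat list \<Rightarrow> nat" where
  "chain_length [] = 1"
| "chain_length (p # ps) = totient (prod_list (p # ps)) + chain_length ps"

lemma chain_length_pos: "chain_length ds > 0"
  by (induction ds) auto

text \<open>A tie of totients is possible here, as in \<open>totient 6 = totient 4\<close> for \<open>ds = [2, 2, 3]\<close> and
  \<open>q = 3\<close>; it only occurs when the smallest prime \<open>p\<close> is repeated, and then the induction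
  hypothesis is strict.\<close>

lemma chain_length_remove1:
  assumes "sorted ds" "\<forall>d\<in>set ds. prime d" "q \<in> set ds"
  shows "chain_length (remove1 q ds) \<le> chain_length (tl ds)"
    and "q \<noteq> hd ds \<Longrightarrow> chain_length (remove1 q ds) < chain_length (tl ds)"
proof -
  have "chain_length (remove1 q ds) \<le> chain_length (tl ds) \<and>
        (q \<noteq> hd ds \<longrightarrow> chain_length (remove1 q ds) < chain_length (tl ds))"
    using assms
  proof (induction ds)
    case (Cons p ps)
    show ?case
    proof (cases "q = p")
      case False
      with Cons.prems have q: "q \<in> set ps" by simp
      with False Cons.prems have pq: "p < q" "prime p" "prime q" by force+
      \<comment> \<open>\<open>r\<close> is the product left once both \<open>p\<close> and
        \<open>q\<close> are gone. The chains to compare start with \<open>totient (p * r)\<close>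
        and \<open>totient (q * r)\<close>; the induction hypothesis for \<open>ps\<close> compares
        what follows.\<close>
      define r where "r = prod_list (remove1 q ps)"
      have ps: "prod_list ps = q * r" using prod_list_remove1[OF q] by (simp add: r_def)
      obtain p' ps' where ps': "ps = p' # ps'" using q by (cases ps) auto
      have IH: "chain_length (remove1 q ps) \<le> chain_length ps'"
        "q \<noteq> p' \<Longrightarrow> chain_length (remove1 q ps) < chain_length ps'"
        using Cons.IH Cons.prems q by (simp_all add: ps')
      have L: "chain_length (remove1 q (p # ps)) = totient (p * r) + chain_length (remove1 q ps)"
        using False by (simp add: r_def)
      have R: "chain_length ps = totient (q * r) + chain_length ps'"
        using ps by (simp add: ps')
      \<comment> \<open>For \<open>q = p'\<close> the remainders coincide, so strictness must come
        from the totients: sortedness and \<open>p < q\<close> keep \<open>p\<close> out of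
        \<open>ps\<close>, hence \<open>p\<close> does not divide \<open>r\<close>.\<close>
      have "totient (p * r) < totient (q * r)" if "q = p'"
      proof (rule totient_prime_mult_strict_mono[OF pq(2,3,1)])
        have "p \<notin> set ps" using Cons.prems(1) pq(1) that by (force simp: ps')
        hence "\<not> p dvd prod_list ps"
          using prime_dvd_prod_list_iff_mem[of ps p] Cons.prems(2) pq(2) by simp
        thus "\<not> p dvd r" by (auto simp: ps)
        show "r > 0" using prod_list_primes_pos[of ps] Cons.prems(2) by (simp add: ps)
      qed
      with IH totient_prime_mult_mono[OF pq(2,3,1), of r]
      have "chain_length (remove1 q (p # ps)) < chain_length ps"
        unfolding L R by (cases "q = p'") auto
      thus ?thesis unfolding list.sel by (intro conjI impI less_imp_le)
    qed auto
  qed auto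
  thus "chain_length (remove1 q ds) \<le> chain_length (tl ds)"
    "q \<noteq> hd ds \<Longrightarrow> chain_length (remove1 q ds) < chain_length (tl ds)"
    by auto
qed

section \<open>Lists made of one block per order\<close>

text \<open>The shape claimed for longest paths, with \<open>C m\<close> standing for the elements
  of order \<open>m\<close>. The recursion lets inductions over the primes peel off one block at a
  time.\<close>

fun block_form :: "(nat \<Rightarrow> 'a set) \<Rightarrow> nat list \<Rightarrow> 'a list \<Rightarrow> bool" where
  "block_form C [] xs \<longleftrightarrow> distinct xs \<and> set xs = C 1"
| "block_form C (p # ps) xs \<longleftrightarrow>
     (\<exists>b ys. xs = b @ ys \<and> distinct b \<and> set b = C (prod_list (p # ps)) \<and> block_form C ps ys)"

text \<open>Links the recursive shape to the indexed blocks of the final statement; the extra block,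
  at index \<open>length ds\<close>, belongs to the empty product 1.\<close>

lemma block_form_iff_concat:
  "block_form C ds xs \<longleftrightarrow>
    (\<exists>bs. xs = concat bs \<and> length bs = length ds + 1 \<and>
      (\<forall>i\<le>length ds. distinct (bs ! i) \<and> set (bs ! i) = C (prod_list (drop i ds))))"
proof (induction ds arbitrary: xs)
  case Nil
  have "(\<exists>bs. P bs \<and> length bs = 1 \<and> Q bs) \<longleftrightarrow> (\<exists>b. P [b] \<and> Q [b])"
    for P Q :: "'a list list \<Rightarrow> bool"
    by (metis One_nat_def length_0_conv length_Suc_conv)
  thus ?case by simp
next
  case (Cons p ps)
  have "(\<exists>bs. xs = concat bs \<and> length bs = length (p # ps) + 1 \<and>
      (\<forall>i\<le>length (p # ps). distinct (bs ! i) \<and> set (bs ! i) = C (prod_list (drop i (p # ps))))) \<longleftrightarrow>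
    (\<exists>b bs. xs = b @ concat bs \<and> length bs = length ps + 1 \<and>
      distinct b \<and> set b = C (prod_list (p # ps)) \<and>
      (\<forall>i\<le>length ps. distinct (bs ! i) \<and> set (bs ! i) = C (prod_list (drop i ps))))"
    (is "(\<exists>bs. ?P bs) \<longleftrightarrow> (\<exists>b bs. ?Q b bs)")
  proof -
    have *: "?P (b # bs) \<longleftrightarrow> ?Q b bs" for b bs
      \<comment> \<open>\<open>All_less_Suc2\<close> splits off index 0 and shifts the other
        indices, which matches head and tail of the block list.\<close>
      by (simp add: All_less_Suc2 flip: less_Suc_eq_le)
    show ?thesis
    proof
      assume "\<exists>bs. ?P bs"
      then obtain bs where bs: "?P bs" by blast
      hence "length bs = Suc (Suc (length ps))" by simp
      then obtain b bs' where b: "bs = b # bs'" unfolding length_Suc_conv by blast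
      from bs have "?Q b bs'" unfolding b * .
      thus "\<exists>b bs. ?Q b bs" by (intro exI)
    next
      assume "\<exists>b bs. ?Q b bs"
      then obtain b bs where "?Q b bs" by (elim exE)
      hence "?P (b # bs)" unfolding * .
      thus "\<exists>bs. ?P bs" by (intro exI)
    qed
  qed
  thus ?case by (simp only: block_form.simps Cons.IH) blast
qed

section \<open>Longest descending lists in a set graded by orders\<close>

text \<open>Isolates what the optimisation takes from a cyclic group of order \<open>n\<close>:
  which orders occur and how many elements have each.\<close>

locale totient_graded =
  fixes V :: "'a set" and ord :: "'a \<Rightarrow> nat" and n :: nat
  assumes n_pos: "n > 0"
    and ord_dvd: "x \<in> V \<Longrightarrow> ord x dvd n"
    and card_level: "m dvd n \<Longrightarrow> card {x \<in> V. ord x = m} = totient m"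
begin

definition level :: "nat \<Rightarrow> 'a set" where
  "level m = {x \<in> V. ord x = m}"

definition descending :: "'a list \<Rightarrow> bool" where
  "descending xs \<longleftrightarrow> distinct xs \<and> set xs \<subseteq> V \<and> sorted_wrt (\<lambda>x y. ord y dvd ord x) xs"

text \<open>An infinite level would have \<open>card\<close> 0, whereas \<open>totient m\<close> is
  positive for \<open>m > 0\<close>.\<close>

lemma finite_level: "m dvd n \<Longrightarrow> finite (level m)"
  using card_level[of m] n_pos unfolding level_def
  by (metis card.infinite dvd_pos_nat totient_0_iff less_not_refl)

lemma length_le_totient:
  assumes "m dvd n" "distinct b" "set b \<subseteq> level m"
  shows "length b \<le> totient m"
    and "length b = totient m \<Longrightarrow> set b = level m"
  using card_mono[OF finite_level[OF assms(1)] assms(3)]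
    card_subset_eq[OF finite_level[OF assms(1)] assms(3)] card_level[OF assms(1)] assms(2)
  by (simp_all add: distinct_card level_def)

text \<open>After the initial run of elements of full order, all later orders divide the product
  with some prime \<open>q\<close> removed. Induction bounds that rest by
  \<open>chain_length (remove1 q ds)\<close>, and \<open>chain_length_remove1\<close> shows that
  only the smallest prime can give equality.\<close>

lemma descending_length:
  assumes "sorted ds" "\<forall>d\<in>set ds. prime d" "prod_list ds dvd n"
    and "descending xs" "\<forall>x\<in>set xs. ord x dvd prod_list ds"
  shows "length xs \<le> chain_length ds \<and> (length xs = chain_length ds \<longrightarrow> block_form level ds xs)"
  using assms
\<comment> \<open>The induction is on the length because the hypothesis is applied to
  \<open>remove1 q ds\<close>, which need not be the tail of \<open>ds\<close>.\<close>
proof (induction "length ds" arbitrary: ds xs)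
  case 0
  hence "set xs \<subseteq> level 1" "distinct xs" "ds = []" by (auto simp: level_def descending_def)
  thus ?case using length_le_totient[of 1 xs] by auto
next
  case (Suc k)
  then obtain p ps where ds: "ds = p # ps" by (cases ds) auto
  define m where "m = prod_list ds"
  define b where "b = takeWhile (\<lambda>x. ord x = m) xs"
  define ys where "ys = dropWhile (\<lambda>x. ord x = m) xs"
  have xs: "xs = b @ ys" by (simp add: b_def ys_def)
  have m: "m dvd n" using Suc.prems(3) by (simp add: m_def)
  have b: "distinct b" "set b \<subseteq> level m"
    using Suc.prems(4) set_takeWhileD[of _ _ xs]
    by (auto simp: b_def level_def descending_def)
  note len_b = length_le_totient[OF m b]
  have cl: "chain_length ds = totient m + chain_length ps" by (simp add: ds m_def)
  show ?case
  proof (cases ys)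
    case Nil
    \<comment> \<open>A list that stops inside the first block misses at least the identity, so
      equality cannot occur.\<close>
    hence "length xs < chain_length ds"
      using len_b(1) chain_length_pos[of ps] by (simp add: cl xs)
    thus ?thesis by simp
  next
    case (Cons y zs)
    \<comment> \<open>\<open>y\<close> is the first element of smaller order; \<open>q\<close> is
      any prime of the cofactor \<open>m / ord y\<close>.\<close>
    have "ord y \<noteq> m" using Cons hd_dropWhile[of "\<lambda>x. ord x = m" xs] by (simp add: ys_def)
    moreover have "ord y dvd m" using Suc.prems(5) by (simp add: xs Cons m_def)
    ultimately obtain k' where k': "m = ord y * k'" "k' \<noteq> 1" by (auto elim: dvdE)
    then obtain q where q: "prime q" "q dvd k'" using prime_factor_nat by blast
    have qds: "q \<in> set ds"
      using prime_dvd_prod_list_iff_mem[OF Suc.prems(2) q(1)] q(2) k'(1) by (simp add: m_def)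
    define r where "r = prod_list (remove1 q ds)"
    have mr: "m = q * r" using prod_list_remove1[OF qds] by (simp add: r_def m_def)
    have yr: "ord y dvd r"
      using k'(1) q mr prime_gt_0_nat[OF q(1)] by (auto elim!: dvdE)
    have ys_ord: "\<forall>x\<in>set ys. ord x dvd r"
      using Suc.prems(4) yr unfolding descending_def xs Cons
      by (auto simp: sorted_wrt_append intro: dvd_trans)
    have desc: "descending ys"
      using Suc.prems(4) by (auto simp: descending_def xs sorted_wrt_append)
    have rn: "r dvd n" using m mr by (metis dvd_mult_right)
    have primes': "\<forall>d\<in>set (remove1 q ds). prime d"
      using Suc.prems(2) set_remove1_subset[of q ds] by blast
    have "k = length (remove1 q ds)" using Suc.hyps(2) qds by (simp add: length_remove1)
    note IH_raw = Suc.hyps(1)[OF this sorted_remove1[OF Suc.prems(1)] primes' rn[unfolded r_def]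
        desc ys_ord[unfolded r_def]]
    have IH: "length ys \<le> chain_length (remove1 q ds)"
      "length ys = chain_length (remove1 q ds) \<Longrightarrow> block_form level (remove1 q ds) ys"
      using IH_raw by blast+
    have rem: "chain_length (remove1 q ds) \<le> chain_length ps"
      "q \<noteq> p \<Longrightarrow> chain_length (remove1 q ds) < chain_length ps"
      using chain_length_remove1[OF Suc.prems(1,2) qds] unfolding ds list.sel .
    have le: "length xs \<le> chain_length ds"
      using IH(1) rem(1) len_b(1) by (simp add: cl xs)
    moreover have "block_form level ds xs" if eq: "length xs = chain_length ds"
    proof -
      \<comment> \<open>Equality of the total makes both partial bounds tight, which rules out the
        strict case of \<open>rem\<close>.\<close>
      have "q = p"
        using rem(2) IH(1) len_b(1) eq by (fastforce simp: cl xs)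
      moreover from this have "length b = totient m" "length ys = chain_length ps"
        using IH(1) rem(1) len_b(1) eq by (simp_all add: cl xs)
      ultimately show ?thesis
        using IH(2) len_b(2) b(1) by (auto simp: ds xs m_def)
    qed
    ultimately show ?thesis by blast
  qed
qed

text \<open>The bound is attained: orders are constant within a block, each block's order divides
  the preceding one, and the block sizes are the summands of \<open>chain_length\<close>.\<close>

lemma block_form_descending:
  assumes "\<forall>d\<in>set ds. prime d" "prod_list ds dvd n" "block_form level ds xs"
  shows "descending xs \<and> (\<forall>x\<in>set xs. ord x dvd prod_list ds) \<and> length xs = chain_length ds"
  using assms
proof (induction ds arbitrary: xs)
  case Nil
  thus ?case using card_level[of 1]
    by (auto simp: descending_def level_def sorted_wrt_iff_nth_less simp flip: distinct_card)
next
  case (Cons p ps)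
  define m where "m = prod_list (p # ps)"
  from Cons.prems(3) obtain b ys where b: "xs = b @ ys" "distinct b" "set b = level m"
    and ys: "block_form level ps ys" by (auto simp: m_def)
  have "prod_list ps dvd n" using Cons.prems(2) by (simp add: dvd_mult_right)
  with Cons.IH Cons.prems(1) ys have IH: "descending ys" "\<forall>x\<in>set ys. ord x dvd prod_list ps"
    "length ys = chain_length ps" by auto
  have "length b = totient m"
    using b card_level[of m] Cons.prems(2) by (simp add: m_def level_def flip: distinct_card)
  hence "length xs = chain_length (p # ps)" by (simp add: b(1) IH(3) m_def)
  moreover have mp: "prod_list ps dvd m" by (simp add: m_def)
  hence "\<forall>x\<in>set xs. ord x dvd m" using b IH(2) by (auto simp: level_def intro: dvd_trans)
  moreover have "set b \<inter> set ys = {}"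
  proof -
    \<comment> \<open>\<open>m\<close> is \<open>p\<close> times the positive number
      \<open>prod_list ps\<close>, hence larger than it; so no later element has order
      \<open>m\<close>.\<close>
    have "\<not> m dvd prod_list ps"
      using Cons.prems(1) prod_list_primes_pos[of ps] by (auto simp: m_def)
    thus ?thesis using IH(2) b(3) by (auto simp: level_def)
  qed
  moreover have "sorted_wrt (\<lambda>x y. ord y dvd ord x) b"
    using b(3) nth_mem[of _ b] by (simp add: level_def sorted_wrt_iff_nth_less)
  ultimately show ?case
    using IH b mp by (auto simp: descending_def sorted_wrt_append level_def m_def intro: dvd_trans)
qed

lemma longest_descending_iff:
  assumes "sorted ds" "\<forall>d\<in>set ds. prime d" "prod_list ds = n"
  shows "descending xs \<and> (\<forall>ys. descending ys \<longrightarrow> length ys \<le> length xs) \<longleftrightarrow> block_form level ds xs"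
proof -
  have bound: "length ys \<le> chain_length ds"
    "length ys = chain_length ds \<Longrightarrow> block_form level ds ys" if "descending ys" for ys
    using descending_length[of ds ys] that assms ord_dvd by (auto simp: descending_def)
  have blocks: "descending ys" "length ys = chain_length ds" if "block_form level ds ys" for ys
    using block_form_descending[of ds ys] that assms by auto
  \<comment> \<open>Enumerating the finite levels yields a list that reaches the bound. The claim is
    for any product dividing \<open>n\<close>, so that the induction can pass to tails.\<close>
  have "\<exists>ys. block_form level es ys" if "prod_list es dvd n" for es
    using that
  proof (induction es)
    case Nil
    thus ?case using finite_distinct_list[OF finite_level[of 1]] by auto
  next
    case (Cons p ps)
    then obtain ys where "block_form level ps ys" by (auto dest: dvd_mult_right)
    moreover obtain b where "distinct b" "set b = level (prod_list (p # ps))"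
      using finite_distinct_list[OF finite_level[OF Cons.prems]] by auto
    ultimately show ?case by auto
  qed
  from this[of ds] obtain ws where ws: "block_form level ds ws" using assms(3) by auto
  show ?thesis
  proof
    assume *: "descending xs \<and> (\<forall>ys. descending ys \<longrightarrow> length ys \<le> length xs)"
    with blocks[OF ws] have "chain_length ds \<le> length xs" by auto
    with bound[of xs] * show "block_form level ds xs" by auto
  next
    assume "block_form level ds xs"
    with blocks[of xs] bound(1) show "descending xs \<and> (\<forall>ys. descending ys \<longrightarrow> length ys \<le> length xs)"
      by auto
  qed
qed

end

section \<open>Directed paths as sorted lists\<close>

text \<open>Inclusion of generated subsets is transitive, so arcs between neighbours give it for all
  pairs; distinctness supplies the condition \<open>x \<noteq> y\<close> on arcs.\<close>

lemma vpath_directed_power_graph_iff: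
  "vpath xs (directed_power_graph G) \<longleftrightarrow> xs \<noteq> [] \<and> distinct xs \<and> set xs \<subseteq> carrier G \<and>
     sorted_wrt (\<lambda>x y. generate G {y} \<subseteq> generate G {x}) xs"
proof -
  have ends: "arcs_ends (directed_power_graph G) =
    {(x, y). x \<in> carrier G \<and> y \<in> carrier G \<and> x \<noteq> y \<and> generate G {y} \<subseteq> generate G {x}}"
    by (auto simp: arcs_ends_def arc_to_ends_def directed_power_graph_def)
  have trans: "transp (\<lambda>x y. generate G {y} \<subseteq> generate G {x})"
    by (auto simp: transp_def)
  have "set (vwalk_arcs xs) \<subseteq> arcs_ends (directed_power_graph G) \<longleftrightarrow>
    sorted_wrt (\<lambda>x y. generate G {y} \<subseteq> generate G {x}) xs"
    if "distinct xs" "set xs \<subseteq> carrier G"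
    using that
  proof (induction xs rule: vwalk_arcs.induct)
    case (3 x y zs)
    thus ?case by (simp add: sorted_wrt2[OF trans] ends del: sorted_wrt.simps)
  qed simp_all
  thus ?thesis
    by (auto simp: vpath_def vwalk_def directed_power_graph_def)
qed

section \<open>Subgroups and generators of Z/nZ\<close>

text \<open>Reduction modulo \<open>n\<close> preserves divisibility by a divisor \<open>d\<close>
  of \<open>n\<close>, and a residue is its own reduction.\<close>

lemma multiples_mod_dvd:
  assumes "d dvd n" "n > 0"
  shows "multiples_mod n d = {y \<in> {0..<int n}. int d dvd y}"
proof -
  have "int d dvd (int d * z) mod int n" for z
    using assms(1) by (simp add: dvd_mod)
  moreover have "y \<in> multiples_mod n d" if "y \<in> {0..<int n}" "int d dvd y" for y
  proof -
    from that(2) obtain z where "y = int d * z" by (elim dvdE)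
    with that(1) have "y = (int d * z) mod int n" by simp
    thus ?thesis unfolding multiples_mod_def by (rule range_eqI)
  qed
  ultimately show ?thesis using assms(2) by (auto simp: multiples_mod_def)
qed

lemma generate_integer_mod_group:
  assumes "n > 0" "x \<in> carrier (integer_mod_group n)"
  shows "generate (integer_mod_group n) {x} = multiples_mod n (nat (gcd x (int n)))"
proof -
  let ?g = "gcd x (int n)"
  have gen: "generate (integer_mod_group n) {x} = range (\<lambda>k. (k * x) mod int n)"
    by (auto simp: group.generate_pow[OF group_integer_mod_group assms(2)] int_pow_integer_mod_group)
  \<comment> \<open>By Bezout the gcd is a multiple of \<open>x\<close> modulo \<open>n\<close>, so
    \<open>x\<close> and the gcd have the same multiples.\<close>
  obtain u v where uv: "u * x + v * int n = ?g" using bezout_int by blast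
  have "(?g * z) mod int n = (u * z * x) mod int n" for z
  proof -
    have "?g * z = u * z * x + v * z * int n" by (simp flip: uv add: algebra_simps)
    thus ?thesis by simp
  qed
  moreover obtain w where "x = ?g * w" by (meson dvdE gcd_dvd1)
  hence "(k * x) mod int n = (?g * (w * k)) mod int n" for k
    by (metis mult.assoc mult.commute)
  ultimately show ?thesis unfolding gen multiples_mod_def by fastforce
qed

lemma multiples_mod_subset_iff:
  assumes "d dvd n" "d' dvd n" "n > 0"
  shows "multiples_mod n d \<subseteq> multiples_mod n d' \<longleftrightarrow> d' dvd d"
proof
  assume "d' dvd d"
  thus "multiples_mod n d \<subseteq> multiples_mod n d'"
    using assms by (auto simp: multiples_mod_dvd intro: dvd_trans[of "int d'" "int d"])
next
  assume sub: "multiples_mod n d \<subseteq> multiples_mod n d'"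
  show "d' dvd d"
  \<comment> \<open>The witness is \<open>d\<close> itself, which is a residue only for
    \<open>d < n\<close>; for \<open>d = n\<close> the claim is a hypothesis.\<close>
  proof (cases "d = n")
    case False
    hence "d < n" using assms by (simp add: dvd_imp_le le_neq_implies_less)
    hence "int d \<in> multiples_mod n d" using assms by (simp add: multiples_mod_dvd)
    hence "int d \<in> multiples_mod n d'" using sub by blast
    thus ?thesis using assms by (simp add: multiples_mod_dvd)
  qed (use assms in simp)
qed

lemma nat_gcd_dvd: "nat (gcd x (int n)) dvd n"
  by (simp add: nat_dvd_iff)

lemma div_dvd_div_iff_dvd:
  assumes "(n::nat) > 0" "a dvd n" "b dvd n"
  shows "n div a dvd n div b \<longleftrightarrow> b dvd a"
proof -
  from assms(2,3) obtain u v where uv: "n = a * u" "n = b * v" by (elim dvdE)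
  have pos: "a > 0" "u > 0" "b > 0" using assms by (auto intro: Nat.gr0I simp: uv(1))
  have "u dvd v \<longleftrightarrow> u * b dvd v * b" using pos by simp
  also have "v * b = a * u" using uv by (simp add: mult.commute)
  also have "u * b dvd a * u \<longleftrightarrow> b dvd a" using pos by (simp add: mult.commute[of a])
  finally show ?thesis using uv pos by (metis nonzero_mult_div_cancel_left less_not_refl)
qed

lemma div_eq_div_iff_eq:
  assumes "(n::nat) > 0" "a dvd n" "b dvd n"
  shows "n div a = n div b \<longleftrightarrow> a = b"
  using div_dvd_div_iff_dvd[OF assms] div_dvd_div_iff_dvd[OF assms(1,3,2)]
  by (metis dvd_antisym dvd_refl)

text \<open>Distinct divisors of \<open>n\<close> give distinct subgroups, so the subgroup generated
  by \<open>x\<close> determines the gcd of \<open>x\<close> and \<open>n\<close>.\<close>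

lemma cyclic_generators_multiples_mod:
  assumes "d dvd n" "n > 0"
  shows "cyclic_generators (integer_mod_group n) (multiples_mod n d) =
    {x \<in> {0..<int n}. nat (gcd x (int n)) = d}"
proof -
  have "multiples_mod n d = multiples_mod n d' \<longleftrightarrow> d' = d" if "d' dvd n" for d'
    using multiples_mod_subset_iff[of d n d'] multiples_mod_subset_iff[of d' n d] assms that
    by (metis dvd_antisym order_refl)
  hence "multiples_mod n (nat (gcd x (int n))) = multiples_mod n d \<longleftrightarrow> nat (gcd x (int n)) = d" for x
    using nat_gcd_dvd by metis
  thus ?thesis using assms(2)
    by (auto simp: cyclic_generators_def generate_integer_mod_group carrier_integer_mod_group)
qed

lemma card_gcd_eq_totient_int:
  assumes "d dvd n" "n > 0"
  shows "card {x \<in> {0..<int n}. nat (gcd x (int n)) = d} = totient (n div d)"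
proof -
  let ?A = "{k\<in>{0<..n}. gcd k n = d}" and ?B = "{x \<in> {0..<int n}. nat (gcd x (int n)) = d}"
  \<comment> \<open>\<open>card_gcd_eq_totient\<close> counts in 1 to \<open>n\<close>, residues run
    from 0 to \<open>n - 1\<close>; \<open>n\<close> and 0 are exchanged, both having gcd
    \<open>n\<close> with \<open>n\<close>.\<close>
  have "bij_betw (\<lambda>k. if k = n then 0 else int k) ?A ?B"
  proof (rule bij_betwI[where g = "\<lambda>x. if x = 0 then n else nat x"])
    show "(\<lambda>k. if k = n then 0 else int k) \<in> ?A \<rightarrow> ?B"
      using assms(2) by auto
    show "(\<lambda>x. if x = 0 then n else nat x) \<in> ?B \<rightarrow> ?A"
    proof
      fix x assume x: "x \<in> ?B"
      then obtain k where "x = int k" by (auto elim: nonneg_int_cases)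
      with x assms(2) show "(if x = 0 then n else nat x) \<in> ?A" by auto
    qed
  qed (use assms(2) in auto)
  thus ?thesis using card_gcd_eq_totient[OF assms(2,1)] by (simp add: bij_betw_same_card)
qed

lemma card_multiples_mod:
  assumes "d dvd n" "n > 0"
  shows "card (multiples_mod n d) = n div d"
proof -
  have d: "d > 0" using assms by (auto intro: Nat.gr0I)
  have "multiples_mod n d = (\<lambda>k. int d * int k) ` {..<n div d}"
  proof -
    have "y \<in> (\<lambda>k. int d * int k) ` {..<n div d}" if "y \<in> {0..<int n}" "int d dvd y" for y
    proof -
      from that(2) obtain z where z: "y = int d * z" by (elim dvdE)
      have "z \<ge> 0" using that(1) d by (simp add: z zero_le_mult_iff)
      then obtain k where k: "z = int k" using nonneg_int_cases by metis
      have "d * k < n" using that(1) by (simp add: z k flip: of_nat_mult)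
      hence "k < n div d" using assms(1) d by (auto elim!: dvdE)
      thus ?thesis by (auto simp: z k)
    qed
    moreover have "d * k < n" if "k < n div d" for k
      using that assms(1) d by (auto elim!: dvdE)
    ultimately show ?thesis
      by (auto simp: multiples_mod_dvd[OF assms] simp flip: of_nat_mult)
  qed
  moreover have "inj_on (\<lambda>k. int d * int k) {..<n div d}" using d by (auto simp: inj_on_def)
  ultimately show ?thesis by (simp add: card_image)
qed

lemma subgroup_multiples_mod:
  assumes "d dvd n" "n > 0"
  shows "subgroup (multiples_mod n d) (integer_mod_group n)"
proof (rule group.subgroupI[OF group_integer_mod_group])
  show "multiples_mod n d \<subseteq> carrier (integer_mod_group n)"
    using assms by (auto simp: multiples_mod_dvd carrier_integer_mod_group)
  show "multiples_mod n d \<noteq> {}" by (simp add: multiples_mod_def)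
next
  fix x y assume "x \<in> multiples_mod n d" "y \<in> multiples_mod n d"
  thus "x \<otimes>\<^bsub>integer_mod_group n\<^esub> y \<in> multiples_mod n d" and
    "inv\<^bsub>integer_mod_group n\<^esub> x \<in> multiples_mod n d"
    using assms by (auto simp: multiples_mod_dvd carrier_integer_mod_group dvd_mod)
qed

section \<open>Longest directed paths in the power graph of Z/nZ\<close>

theorem theorem5:
  fixes n :: nat and ds :: "nat list"
  assumes "n \<ge> 1"
    and "n = prod_list ds"
    and "\<forall>d \<in> set ds. prime d"
    and "sorted ds"
  defines "Zn \<equiv> integer_mod_group n"
    and "e \<equiv> (\<lambda>i. prod_list (take i ds))"
  shows "(\<forall>i \<le> length ds.
            subgroup (multiples_mod n (e i)) Zn \<and>
            card (multiples_mod n (e i)) = n div e i \<and>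
            card (cyclic_generators Zn (multiples_mod n (e i))) = totient (n div e i)) \<and>
         multiples_mod n (e 0) = carrier Zn \<and>
         multiples_mod n (e (length ds)) = {\<one>\<^bsub>Zn\<^esub>} \<and>
         cyclic_generators Zn (multiples_mod n (e (length ds))) = {\<one>\<^bsub>Zn\<^esub>} \<and>
         (\<forall>p. longest_vpath p (directed_power_graph Zn) \<longleftrightarrow>
            (\<exists>bs. p = concat bs \<and>
                  length bs = length ds + 1 \<and>
                  (\<forall>i \<le> length ds.
                     distinct (bs ! i) \<and>
                     set (bs ! i) = cyclic_generators Zn (multiples_mod n (e i)))))"
proof -
  have n: "n > 0" using assms(1) by simp
  \<comment> \<open>Relates the prefix products \<open>e i\<close>, which name the subgroups, to the
    suffix products, which are their orders.\<close>
  have split: "n = e i * prod_list (drop i ds)" for i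
    unfolding e_def assms(2) by (metis append_take_drop_id prod_list.append)
  have e: "e i dvd n" for i by (metis dvd_triv_left split)
  have e_ends: "e 0 = 1" "e (length ds) = n" by (simp_all add: e_def assms(2))
  have carr: "carrier Zn = {0..<int n}" using n by (simp add: Zn_def carrier_integer_mod_group)
  have "multiples_mod n 1 = carrier Zn" using n by (auto simp: multiples_mod_dvd carr)
  moreover have "multiples_mod n n = {\<one>\<^bsub>Zn\<^esub>}"
    using n by (auto simp: multiples_mod_def Zn_def)
  moreover have "cyclic_generators Zn (multiples_mod n n) = {\<one>\<^bsub>Zn\<^esub>}"
  proof -
    have "x = 0" if "0 \<le> x" "x < int n" "nat (gcd x (int n)) = n" for x
    proof -
      have "int n dvd x" using that(3) by (metis gcd_dvd1 gcd_ge_0_int int_nat_eq)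
      thus ?thesis using that(1,2) by (auto dest: zdvd_imp_le)
    qed
    thus ?thesis using n by (auto simp: Zn_def cyclic_generators_multiples_mod)
  qed
  moreover have "longest_vpath p (directed_power_graph Zn) \<longleftrightarrow>
            (\<exists>bs. p = concat bs \<and> length bs = length ds + 1 \<and>
                  (\<forall>i \<le> length ds. distinct (bs ! i) \<and>
                     set (bs ! i) = cyclic_generators Zn (multiples_mod n (e i))))" for p
  proof -
    \<comment> \<open>The additive order of the residue \<open>x\<close>; for \<open>x = 0\<close>
      the gcd is \<open>n\<close> and the order is 1.\<close>
    define ord where "ord = (\<lambda>x. n div nat (gcd x (int n)))"
    have ord_eq: "ord x = n div d \<longleftrightarrow> nat (gcd x (int n)) = d" if "d dvd n" for x d
      using div_eq_div_iff_eq[OF n nat_gcd_dvd[of x] that] by (simp add: ord_def)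
    interpret totient_graded "{0..<int n}" ord n
    proof
      show "ord x dvd n" for x
        using nat_gcd_dvd[of x n] unfolding ord_def by (metis dvd_div_mult_self dvd_triv_left)
      show "card {x \<in> {0..<int n}. ord x = m} = totient m" if "m dvd n" for m
        using card_gcd_eq_totient_int[of "n div m" n] ord_eq[of "n div m"] that n by auto
    qed (fact n)
    \<comment> \<open>Inclusion of subgroups reverses divisibility of the gcds, and passing to
      \<open>n\<close> divided by the gcd reverses it again.\<close>
    have edge: "generate Zn {y} \<subseteq> generate Zn {x} \<longleftrightarrow> ord y dvd ord x"
      if "x \<in> carrier Zn" "y \<in> carrier Zn" for x y
      using that n multiples_mod_subset_iff[OF nat_gcd_dvd nat_gcd_dvd n, of y x]
        div_dvd_div_iff_dvd[OF n nat_gcd_dvd[of y] nat_gcd_dvd[of x]]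
      by (simp add: Zn_def generate_integer_mod_group ord_def)
    have path: "vpath xs (directed_power_graph Zn) \<longleftrightarrow> xs \<noteq> [] \<and> descending xs" for xs
    proof -
      have "sorted_wrt (\<lambda>x y. generate Zn {y} \<subseteq> generate Zn {x}) xs \<longleftrightarrow>
        sorted_wrt (\<lambda>x y. ord y dvd ord x) xs" if "set xs \<subseteq> carrier Zn"
        unfolding sorted_wrt_iff_nth_less using edge nth_mem[of _ xs] that
        by (meson order_less_trans subsetD)
      thus ?thesis unfolding vpath_directed_power_graph_iff descending_def carr by blast
    qed
    \<comment> \<open>A descending list of length one exists, so a longest one is nonempty; this
      reconciles \<open>descending\<close>, which allows \<open>[]\<close>, with
      \<open>vpath\<close>, which does not.\<close>
    have one: "descending [0]" using n by (simp add: descending_def)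
    have level_eq: "level (prod_list (drop i ds)) = cyclic_generators Zn (multiples_mod n (e i))" for i
    proof -
      have "prod_list (drop i ds) = n div e i"
        using split[of i] n by (metis nonzero_mult_div_cancel_left mult_0 less_irrefl)
      thus ?thesis using ord_eq[OF e[of i]]
        by (simp add: level_def Zn_def cyclic_generators_multiples_mod[OF e n])
    qed
    have "longest_vpath p (directed_power_graph Zn) \<longleftrightarrow>
      descending p \<and> (\<forall>q. descending q \<longrightarrow> length q \<le> length p)"
    proof -
      have "p \<noteq> []" if "\<forall>q. descending q \<longrightarrow> length q \<le> length p"
        using that one by fastforce
      moreover have "descending []" by (simp add: descending_def)
      ultimately show ?thesis unfolding longest_vpath_def path by (metis le0 list.size(3))
    qed
    also have "\<dots> \<longleftrightarrow> block_form level ds p"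
      by (rule longest_descending_iff[OF assms(4,3) assms(2)[symmetric]])
    also have "\<dots> \<longleftrightarrow> (\<exists>bs. p = concat bs \<and> length bs = length ds + 1 \<and>
                  (\<forall>i \<le> length ds. distinct (bs ! i) \<and>
                     set (bs ! i) = cyclic_generators Zn (multiples_mod n (e i))))"
      unfolding block_form_iff_concat level_eq ..
    finally show ?thesis .
  qed
  ultimately show ?thesis
    using e n card_gcd_eq_totient_int
    by (simp add: e_ends Zn_def subgroup_multiples_mod card_multiples_mod cyclic_generators_multiples_mod)
qed

end
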